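(* Let $\Omega\subset\mathbb{R}$ be a bounded measurable set, let $1<p<\infty$ and $\theta\geq 0$, let $U$ be a neighbourhood of $0$ in $\mathbb{R}$, and let $(x_i)_{i\in I}\subset\Omega$ be a well-spread family in $\Omega$ (with respect to $U$). Then the discrete space associated with the generalized grand Lebesgue space $L^{p),\theta}(\Omega)$ is the grand Lebesgue sequence space $\ell^{p),\theta}(I)$, that is, $$\left(L^{p),\theta}\right)_d=\ell^{p),\theta}(I).$$
   Context: $\mu$ (also written $dx$) denotes Lebesgue measure and $\|\cdot\|_{r}$ the $L^r(\Omega)$-norm. Generalized grand Lebesgue space: for $1<p<\infty$, $\theta\ge 0$, $L^{p),\theta}(\Omega)$ is the space of (classes of) measurable functions $f$ on $\Omega$ with $$\|f\|_{p),\theta}=\sup_{0<\varepsilon\le p-1}\varepsilon^{\frac{\theta}{p-\varepsilon}}\Big(\int_\Omega|f|^{p-\varepsilon}d\mu\Big)^{\frac1{p-\varepsilon}}<\infty;$$ for $\theta=0$ it is $L^p(\Omega)$. Grand Lebesgue sequence space: $\ell^{p),\theta}(I)$ is the space of families $u=(u_k)_{k\in I}$ of scalars with $$\|u\|_{\ell^{p),\theta}(I)}=\sup_{0<\varepsilon\le p-1}\Big(\varepsilon^{\theta}\sum_{k\in I}|u_k|^{p-\varepsilon}\Big)^{\frac1{p-\varepsilon}}<\infty.$$ Well-spread family: a family $(x_i)_{i\in I}$ is $U$-dense if the sets $x_i+U$, $i\in I$, cover $\Omega$; it is separated if the sets $x_i+U$, $i\in I$, are pairwise disjoint; it is relatively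 separated if it is a finite union of separated families; it is well-spread if it is both $U$-dense and relatively separated. Associated discrete space: given a well-spread family $(x_i)_{i\in I}\subset\Omega$, $$\left(L^{p),\theta}\right)_d=\Big\{\Lambda=(\lambda_i)_{i\in I}:\ \sum_{i\in I}|\lambda_i|\chi_{x_i+U}\in L^{p),\theta}(\Omega)\Big\},\qquad \|\Lambda\|_{(L^{p),\theta})_d}=\Big\|\sum_{i\in I}|\lambda_i|\chi_{x_i+U}\Big\|_{p),\theta},$$ where the $\lambda_i$ are scalars and characteristic functions are restricted to $\Omega$.
   Formalization: U is assumed Lebesgue measurable (otherwise the characteristic functions may be non-measurable and the equality fails); equality is of sets plus norm bounds, the bound of the sequence norm by the discrete norm being claimed only when the discrete functional vanishes only at zero. *)

theory Defs
  imports "HOL-Analysis.Analysis"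
begin

(* Only used with exponents r > 0, where the power of top is top. *)
definition ennreal_powr :: "ennreal \<Rightarrow> real \<Rightarrow> ennreal" where
  "ennreal_powr a r = (if a = top then top else ennreal (enn2real a powr r))"

definition grand_Lebesgue_norm ::
    "real \<Rightarrow> real \<Rightarrow> real set \<Rightarrow> (real \<Rightarrow> 'a::real_normed_vector) \<Rightarrow> ennreal" where
  "grand_Lebesgue_norm p \<theta> \<Omega> f =
     (SUP \<epsilon>\<in>{0<..p - 1}. ennreal (\<epsilon> powr (\<theta> / (p - \<epsilon>))) *
        ennreal_powr (\<integral>\<^sup>+ t. ennreal (norm (f t) powr (p - \<epsilon>)) \<partial>lebesgue_on \<Omega>) (1 / (p - \<epsilon>)))"

(* Functions rather than almost-everywhere classes: membership and norm depend only on the class. *)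
definition grand_Lebesgue ::
    "real \<Rightarrow> real \<Rightarrow> real set \<Rightarrow> (real \<Rightarrow> 'a::real_normed_vector) set" where
  "grand_Lebesgue p \<theta> \<Omega> =
     {f. f \<in> borel_measurable (lebesgue_on \<Omega>) \<and> grand_Lebesgue_norm p \<theta> \<Omega> f < top}"

definition grand_lseq_norm ::
    "real \<Rightarrow> real \<Rightarrow> 'i set \<Rightarrow> ('i \<Rightarrow> 'a::real_normed_field) \<Rightarrow> ennreal" where
  "grand_lseq_norm p \<theta> I u =
     (SUP \<epsilon>\<in>{0<..p - 1}.
        ennreal_powr (ennreal (\<epsilon> powr \<theta>) * (\<Sum>\<^sub>\<infinity>k\<in>I. ennreal (norm (u k) powr (p - \<epsilon>))))
          (1 / (p - \<epsilon>)))"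

(* A family indexed by I is a function that is extensional on I, so that equality of functions
   is equality of families. *)
definition grand_lseq ::
    "real \<Rightarrow> real \<Rightarrow> 'i set \<Rightarrow> ('i \<Rightarrow> 'a::real_normed_field) set" where
  "grand_lseq p \<theta> I = {u \<in> extensional I. grand_lseq_norm p \<theta> I u < top}"

definition U_dense :: "real set \<Rightarrow> real set \<Rightarrow> ('i \<Rightarrow> real) \<Rightarrow> 'i set \<Rightarrow> bool" where
  "U_dense \<Omega> U x I \<longleftrightarrow> \<Omega> \<subseteq> (\<Union>i\<in>I. (+) (x i) ` U)"

definition separated_family :: "real set \<Rightarrow> ('i \<Rightarrow> real) \<Rightarrow> 'i set \<Rightarrow> bool" where
  "separated_family U x I \<longleftrightarrow> disjoint_family_on (\<lambda>i. (+) (x i) ` U) I"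

definition relatively_separated :: "real set \<Rightarrow> ('i \<Rightarrow> real) \<Rightarrow> 'i set \<Rightarrow> bool" where
  "relatively_separated U x I \<longleftrightarrow>
     (\<exists>\<J>. finite \<J> \<and> \<Union>\<J> = I \<and> (\<forall>J\<in>\<J>. separated_family U x J))"

definition well_spread :: "real set \<Rightarrow> real set \<Rightarrow> ('i \<Rightarrow> real) \<Rightarrow> 'i set \<Rightarrow> bool" where
  "well_spread \<Omega> U x I \<longleftrightarrow> U_dense \<Omega> U x I \<and> relatively_separated U x I"

(* For a relatively separated family each point lies in only finitely many of the sets x i + U,
   so the sum has finitely many nonzero terms at each point. *)
definition step_function ::
    "real set \<Rightarrow> ('i \<Rightarrow> real) \<Rightarrow> 'i set \<Rightarrow> ('i \<Rightarrow> 'a::real_normed_field) \<Rightarrow> real \<Rightarrow> real" where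
  "step_function U x I \<Lambda> t = (\<Sum>\<^sub>\<infinity>i\<in>I. norm (\<Lambda> i) * indicator ((+) (x i) ` U) t)"

definition discrete_norm ::
    "real \<Rightarrow> real \<Rightarrow> real set \<Rightarrow> real set \<Rightarrow> ('i \<Rightarrow> real) \<Rightarrow> 'i set
       \<Rightarrow> ('i \<Rightarrow> 'a::real_normed_field) \<Rightarrow> ennreal" where
  "discrete_norm p \<theta> \<Omega> U x I \<Lambda> = grand_Lebesgue_norm p \<theta> \<Omega> (step_function U x I \<Lambda>)"

definition discrete_space ::
    "real \<Rightarrow> real \<Rightarrow> real set \<Rightarrow> real set \<Rightarrow> ('i \<Rightarrow> real) \<Rightarrow> 'i set
       \<Rightarrow> ('i \<Rightarrow> 'a::real_normed_field) set" where
  "discrete_space p \<theta> \<Omega> U x I =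
     {\<Lambda> \<in> extensional I. step_function U x I \<Lambda> \<in> grand_Lebesgue p \<theta> \<Omega>}"

end

theory Submission
  imports Defs
begin

text \<open>A separated family in a bounded set is finite, because \<open>U\<close> contains a ball around \<open>0\<close>, so
  \<open>I\<close> is finite.  For every exponent \<open>q = p - \<epsilon> \<in> [1, p)\<close> the sum \<open>\<Sum>\<^sub>i |\<Lambda>\<^sub>i|\<^sup>q\<close> and the integral over
  \<open>\<Omega>\<close> of the \<open>q\<close>-th power of the step function are then comparable with constants that do not depend
  on \<open>q\<close>; taking \<open>q\<close>-th roots keeps constants \<open>\<ge> 1\<close> bounded.  Bounding the sum by the integral
  requires every \<open>\<Omega> \<inter> (x\<^sub>i + U)\<close> to have positive measure, which is what definiteness of the
  discrete norm gives when tested on unit vectors.\<close>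

section \<open>Finiteness of the index set\<close>

lemma finite_separated_family:
  assumes "separated_family U x J" "0 \<in> interior U" "bounded (x ` J)"
  shows "finite J"
proof -
  obtain e where e: "e > 0" "ball 0 e \<subseteq> U"
    using assms(2) by (meson mem_interior)
  have sep: "i = j" if "i \<in> J" "j \<in> J" "dist (x i) (x j) < e" for i j
  proof (rule ccontr)
    assume "i \<noteq> j"
    then have "(+) (x i) ` U \<inter> (+) (x j) ` U = {}"
      using assms(1) that by (auto simp: separated_family_def disjoint_family_on_def)
    moreover have "x i \<in> (+) (x i) ` U"
      using e by (intro image_eqI[of _ _ 0]) auto
    moreover have "x i \<in> (+) (x j) ` U"
      using e(2) that(3) by (intro image_eqI[of _ _ "x i - x j"]) (auto simp: dist_real_def)
    ultimately show False by blast
  qed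
  have "uniform_discrete (x ` J)"
    unfolding uniform_discrete_def using sep e(1) by blast
  with assms(3) have "finite (x ` J)"
    using uniform_discrete_finite_iff by blast
  \<comment> \<open>A family may repeat points, so finiteness of the image alone is not enough;
    equal points have distance 0 < \<open>e\<close> and hence equal indices.\<close>
  moreover have "inj_on x J"
    using sep e(1) by (intro inj_onI) auto
  ultimately show ?thesis
    using finite_imageD by blast
qed

lemma finite_relatively_separated:
  assumes "relatively_separated U x I" "0 \<in> interior U" "bounded (x ` I)"
  shows "finite I"
proof -
  obtain \<J> where \<J>: "finite \<J>" "\<Union>\<J> = I" "\<forall>J\<in>\<J>. separated_family U x J"
    using assms(1) by (auto simp: relatively_separated_def)
  have "finite J" if "J \<in> \<J>" for J
    using that \<J> assms(2) bounded_subset[OF assms(3), of "x ` J"]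
    by (intro finite_separated_family[of U x J]) auto
  then show ?thesis using \<J> by blast
qed

section \<open>Roots in \<open>ennreal\<close> and weighted suprema\<close>

lemma ennreal_powr_mono: "0 < r \<Longrightarrow> a \<le> b \<Longrightarrow> ennreal_powr a r \<le> ennreal_powr b r"
  by (auto simp: ennreal_powr_def top_unique less_top intro!: ennreal_leI powr_mono2 enn2real_mono)

lemma ennreal_powr_mult:
  assumes "0 < c"
  shows "ennreal_powr (ennreal c * a) r = ennreal (c powr r) * ennreal_powr a r"
  using assms
  by (auto simp: ennreal_powr_def ennreal_mult_top ennreal_mult_eq_top_iff enn2real_mult powr_mult
      ennreal_mult)

text \<open>For a constant \<open>c\<close> \<ge> 1 and an exponent \<open>r\<close> \<le> 1 one has
  \<open>c powr r\<close> \<le> \<open>c\<close>, so a single constant survives all the roots of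
  order \<open>p - \<epsilon>\<close>.\<close>

lemma ennreal_powr_le_mult:
  assumes "a \<le> ennreal c * b" "1 \<le> c" "0 < r" "r \<le> 1"
  shows "ennreal_powr a r \<le> ennreal c * ennreal_powr b r"
proof -
  have "ennreal_powr a r \<le> ennreal (c powr r) * ennreal_powr b r"
    using ennreal_powr_mono[OF assms(3,1)] assms(2) by (simp add: ennreal_powr_mult)
  also have "c powr r \<le> c powr 1"
    using assms by (intro powr_mono) auto
  then have "ennreal (c powr r) * ennreal_powr b r \<le> ennreal c * ennreal_powr b r"
    using assms by (intro mult_right_mono ennreal_leI) auto
  finally show ?thesis .
qed

text \<open>Pulling the factor in \<epsilon> out of the root gives the sequence norm the same
  weights as the function norm, so that the two can be compared separately for each
  \<epsilon>.\<close>

lemma grand_lseq_norm_altdef: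
  assumes "finite I"
  shows "grand_lseq_norm p \<theta> I u =
    (SUP \<epsilon>\<in>{0<..p - 1}. ennreal (\<epsilon> powr (\<theta> / (p - \<epsilon>))) *
       ennreal_powr (ennreal (\<Sum>k\<in>I. norm (u k) powr (p - \<epsilon>))) (1 / (p - \<epsilon>)))"
  using assms unfolding grand_lseq_norm_def
  by (intro SUP_cong) (auto simp: ennreal_powr_mult powr_powr)

lemma SUP_mult_mono_ennreal:
  fixes w f g :: "'b \<Rightarrow> ennreal"
  assumes "\<And>e. e \<in> A \<Longrightarrow> f e \<le> c * g e"
  shows "(SUP e\<in>A. w e * f e) \<le> c * (SUP e\<in>A. w e * g e)"
proof (rule SUP_least)
  fix e assume e: "e \<in> A"
  have "w e * f e \<le> c * (w e * g e)"
    using mult_left_mono[OF assms[OF e], of "w e"] by (simp add: ac_simps)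
  also have "\<dots> \<le> c * (SUP e\<in>A. w e * g e)"
    using e by (intro mult_left_mono SUP_upper) auto
  finally show "w e * f e \<le> c * (SUP e\<in>A. w e * g e)" .
qed

text \<open>The exponents \<open>p - \<epsilon>\<close> stay in [1, p), so a finite sum of powers is
  bounded uniformly in \<epsilon>, and so is the weight because \<epsilon> <
  \<open>p\<close>.\<close>

lemma grand_lseq_norm_finite:
  assumes "finite I" "1 < p" "0 \<le> \<theta>"
  shows "grand_lseq_norm p \<theta> I u < top"
proof -
  \<comment> \<open>Bases \<open>1 + norm (u k)\<close> are at least 1, so their powers grow with
    the exponent and \<open>p\<close> dominates; the leading 1 pays for removing the root through
    \<open>S powr r\<close> \<le> \<open>1 + S\<close> with \<open>r\<close> \<le> 1.\<close>
  define B where "B = 1 + p powr \<theta> * (\<Sum>k\<in>I. (1 + norm (u k)) powr p)"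
  have "grand_lseq_norm p \<theta> I u \<le> ennreal B"
    unfolding grand_lseq_norm_def
  proof (rule SUP_least)
    fix \<epsilon> assume e: "\<epsilon> \<in> {0<..p - 1}"
    define S where "S = \<epsilon> powr \<theta> * (\<Sum>k\<in>I. norm (u k) powr (p - \<epsilon>))"
    have S0: "0 \<le> S" by (auto simp: S_def intro!: mult_nonneg_nonneg sum_nonneg)
    have "S \<le> p powr \<theta> * (\<Sum>k\<in>I. (1 + norm (u k)) powr p)"
      unfolding S_def
    proof (intro mult_mono sum_mono sum_nonneg)
      show "\<epsilon> powr \<theta> \<le> p powr \<theta>" using e assms by (intro powr_mono2) auto
      fix k
      have "norm (u k) powr (p - \<epsilon>) \<le> (1 + norm (u k)) powr (p - \<epsilon>)"
        using e by (intro powr_mono2) auto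
      also have "\<dots> \<le> (1 + norm (u k)) powr p"
        using e by (intro powr_mono) auto
      finally show "norm (u k) powr (p - \<epsilon>) \<le> (1 + norm (u k)) powr p" .
    qed auto
    moreover have "S powr (1 / (p - \<epsilon>)) \<le> 1 + S"
    proof -
      have "S powr (1 / (p - \<epsilon>)) \<le> (1 + S) powr (1 / (p - \<epsilon>))"
        using e S0 by (intro powr_mono2) auto
      also have "\<dots> \<le> (1 + S) powr 1"
        using e S0 by (intro powr_mono) auto
      finally show ?thesis using S0 by simp
    qed
    ultimately have "S powr (1 / (p - \<epsilon>)) \<le> B" by (simp add: B_def)
    moreover have "ennreal (\<epsilon> powr \<theta>) * (\<Sum>\<^sub>\<infinity>k\<in>I. ennreal (norm (u k) powr (p - \<epsilon>))) = ennreal S"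
      using assms(1) by (simp add: S_def ennreal_mult sum_nonneg)
    ultimately show "ennreal_powr (ennreal (\<epsilon> powr \<theta>) *
        (\<Sum>\<^sub>\<infinity>k\<in>I. ennreal (norm (u k) powr (p - \<epsilon>)))) (1 / (p - \<epsilon>)) \<le> ennreal B"
      using S0 by (simp add: ennreal_powr_def ennreal_leI)
  qed
  then show ?thesis by (simp add: le_less_trans)
qed

text \<open>The sum is at most \<open>card I\<close> times its largest term, and the power of that
  term is one summand on the right.\<close>

lemma powr_sum_le_card_powr_mult_sum:
  fixes f :: "'b \<Rightarrow> real"
  assumes "finite I" "\<And>i. i \<in> I \<Longrightarrow> 0 \<le> f i" "0 \<le> q"
  shows "(\<Sum>i\<in>I. f i) powr q \<le> real (card I) powr q * (\<Sum>i\<in>I. f i powr q)"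
proof (cases "I = {}")
  case False
  define M where "M = Max (f ` I)"
  have le: "f i \<le> M" if "i \<in> I" for i
    using that assms(1) by (simp add: M_def)
  have "M \<in> f ` I"
    unfolding M_def using assms(1) False by (intro Max_in) auto
  then obtain j where j: "j \<in> I" "f j = M" by blast
  have "(\<Sum>i\<in>I. f i) powr q \<le> (real (card I) * M) powr q"
    using assms le by (intro powr_mono2 sum_nonneg sum_bounded_above) auto
  also have "\<dots> = real (card I) powr q * f j powr q"
    using j assms(2)[OF j(1)] by (simp add: powr_mult)
  also have "\<dots> \<le> real (card I) powr q * (\<Sum>i\<in>I. f i powr q)"
    using assms j by (intro mult_left_mono member_le_sum) auto
  finally show ?thesis .
qed simp

section \<open>The step function of a finite family\<close>

lemma step_function_altdef:
  assumes "finite I"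
  shows "step_function U x I \<Lambda> t = (\<Sum>i\<in>I. norm (\<Lambda> i) * indicator ((+) (x i) ` U) t)"
  using assms by (simp add: step_function_def)

lemma step_function_nonneg: "finite I \<Longrightarrow> 0 \<le> step_function U x I \<Lambda> t"
  by (simp add: step_function_altdef sum_nonneg)

lemma step_function_le_sum:
  assumes "finite I"
  shows "step_function U x I \<Lambda> t \<le> (\<Sum>i\<in>I. norm (\<Lambda> i))"
  unfolding step_function_altdef[OF assms]
  by (intro sum_mono) (simp add: indicator_def)

lemma norm_le_step_function:
  assumes "finite I" "i \<in> I" "t \<in> (+) (x i) ` U"
  shows "norm (\<Lambda> i) \<le> step_function U x I \<Lambda> t"
proof -
  have "norm (\<Lambda> i) = norm (\<Lambda> i) * indicator ((+) (x i) ` U) t"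
    using assms(3) by simp
  also have "\<dots> \<le> step_function U x I \<Lambda> t"
    unfolding step_function_altdef[OF assms(1)] using assms(1,2) by (intro member_le_sum) auto
  finally show ?thesis .
qed

lemma translation_in_lebesgue_on:
  fixes a :: real
  assumes "\<Omega> \<in> sets lebesgue" "U \<in> sets lebesgue"
  shows "\<Omega> \<inter> (+) a ` U \<in> sets (lebesgue_on \<Omega>)"
  using assms lebesgue_sets_translation[of U a] by (auto simp: sets_restrict_space)

lemma step_function_measurable:
  assumes "finite I" "\<Omega> \<in> sets lebesgue" "U \<in> sets lebesgue"
  shows "step_function U x I \<Lambda> \<in> borel_measurable (lebesgue_on \<Omega>)"
proof -
  have [measurable]: "indicator ((+) (x i) ` U) \<in> borel_measurable (lebesgue_on \<Omega>)" for i
    using lebesgue_sets_translation[OF assms(3), of "x i"]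
    by (intro measurable_restrict_space1) simp
  show ?thesis
    unfolding step_function_altdef[OF assms(1), abs_def] by measurable
qed

section \<open>Comparison of the two norms\<close>

text \<open>The step function is at most the sum of all \<open>norm (\<Lambda> i)\<close>; its power
  is then a constant times the sum of powers, and integrating over \<Omega> only adds the factor of
  finite measure.\<close>

lemma discrete_norm_le:
  fixes \<Omega> U :: "real set" and x :: "'i \<Rightarrow> real" and \<Lambda> :: "'i \<Rightarrow> 'a::real_normed_field"
  assumes "finite I" "\<Omega> \<in> lmeasurable"
  shows "discrete_norm p \<theta> \<Omega> U x I \<Lambda> \<le>
    ennreal ((1 + card I) powr p * (1 + measure lebesgue \<Omega>)) * grand_lseq_norm p \<theta> I \<Lambda>"
  unfolding discrete_norm_def grand_Lebesgue_norm_def grand_lseq_norm_altdef[OF assms(1)]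
proof (rule SUP_mult_mono_ennreal)
  fix \<epsilon> assume e: "\<epsilon> \<in> {0<..p - 1}"
  define q where "q = p - \<epsilon>"
  define S where "S = (\<Sum>i\<in>I. norm (\<Lambda> i) powr q)"
  have q: "1 \<le> q" "q \<le> p" and S0: "0 \<le> S"
    using e by (auto simp: q_def S_def sum_nonneg)
  have pw: "norm (step_function U x I \<Lambda> t) powr q \<le> (1 + card I) powr p * S" for t
  proof -
    have "norm (step_function U x I \<Lambda> t) powr q \<le> (\<Sum>i\<in>I. norm (\<Lambda> i)) powr q"
      using q step_function_nonneg[OF assms(1), of U x \<Lambda> t]
        step_function_le_sum[OF assms(1), of U x \<Lambda> t]
      by (intro powr_mono2) auto
    also have "\<dots> \<le> real (card I) powr q * S"
      unfolding S_def using q assms(1) by (intro powr_sum_le_card_powr_mult_sum) auto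
    \<comment> \<open>The base is raised to at least 1 so that the exponent can next be raised to
      \<open>p\<close>, which frees the constant from \<epsilon>.\<close>
    also have "\<dots> \<le> (1 + card I) powr q * S"
      using q S0 by (intro mult_right_mono powr_mono2) auto
    also have "\<dots> \<le> (1 + card I) powr p * S"
      using q S0 by (intro mult_right_mono powr_mono) auto
    finally show ?thesis .
  qed
  have "(\<integral>\<^sup>+ t. ennreal (norm (step_function U x I \<Lambda> t) powr q) \<partial>lebesgue_on \<Omega>)
      \<le> (\<integral>\<^sup>+ t. ennreal ((1 + card I) powr p * S) \<partial>lebesgue_on \<Omega>)"
    using pw by (intro nn_integral_mono ennreal_leI)
  also have "\<dots> = ennreal ((1 + card I) powr p * S) * ennreal (measure lebesgue \<Omega>)"
    using assms(2) by (simp add: emeasure_restrict_space emeasure_eq_measure2 fmeasurableD)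
  \<comment> \<open>Enlarging the measure by 1 makes the final constant at least 1, as taking roots
    requires.\<close>
  also have "\<dots> \<le> ennreal ((1 + card I) powr p * S) * ennreal (1 + measure lebesgue \<Omega>)"
    by (intro mult_left_mono ennreal_leI) auto
  also have "\<dots> = ennreal ((1 + card I) powr p * (1 + measure lebesgue \<Omega>)) * ennreal S"
    using S0 by (simp add: ac_simps del: ennreal_plus flip: ennreal_mult'')
  finally have "(\<integral>\<^sup>+ t. ennreal (norm (step_function U x I \<Lambda> t) powr q) \<partial>lebesgue_on \<Omega>)
      \<le> ennreal ((1 + card I) powr p * (1 + measure lebesgue \<Omega>)) * ennreal S" .
  moreover have "1 \<le> (1 + real (card I)) powr p * (1 + measure lebesgue \<Omega>)"
    using q mult_mono[of 1 "(1 + real (card I)) powr p" 1 "1 + measure lebesgue \<Omega>"]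
    by (simp add: ge_one_powr_ge_zero)
  ultimately show "ennreal_powr
      (\<integral>\<^sup>+ t. ennreal (norm (step_function U x I \<Lambda> t) powr (p - \<epsilon>)) \<partial>lebesgue_on \<Omega>) (1 / (p - \<epsilon>))
    \<le> ennreal ((1 + card I) powr p * (1 + measure lebesgue \<Omega>)) *
      ennreal_powr (ennreal (\<Sum>k\<in>I. norm (\<Lambda> k) powr (p - \<epsilon>))) (1 / (p - \<epsilon>))"
    using q by (intro ennreal_powr_le_mult) (auto simp: q_def S_def)
qed

text \<open>On \<Omega> \<inter> (\<open>x i\<close> + \<open>U\<close>) the step function is at
  least \<open>norm (\<Lambda> i)\<close>, so a Chebyshev estimate bounds each power by the integral
  divided by \<open>m i\<close>; summing over \<open>i\<close> gives the constant, and the extra 1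
  makes it at least 1.\<close>

lemma grand_lseq_norm_le:
  fixes \<Omega> U :: "real set" and x :: "'i \<Rightarrow> real" and \<Lambda> :: "'i \<Rightarrow> 'a::real_normed_field"
  defines "m \<equiv> \<lambda>i. measure lebesgue (\<Omega> \<inter> (+) (x i) ` U)"
  assumes "finite I" "\<Omega> \<in> lmeasurable" "U \<in> sets lebesgue" "\<And>i. i \<in> I \<Longrightarrow> 0 < m i"
  shows "grand_lseq_norm p \<theta> I \<Lambda> \<le>
    ennreal (1 + (\<Sum>i\<in>I. 1 / m i)) * discrete_norm p \<theta> \<Omega> U x I \<Lambda>"
  unfolding discrete_norm_def grand_Lebesgue_norm_def grand_lseq_norm_altdef[OF assms(2)]
proof (rule SUP_mult_mono_ennreal)
  fix \<epsilon> assume e: "\<epsilon> \<in> {0<..p - 1}"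
  define q where "q = p - \<epsilon>"
  define J where
    "J = (\<integral>\<^sup>+ t. ennreal (norm (step_function U x I \<Lambda> t) powr q) \<partial>lebesgue_on \<Omega>)"
  have q: "1 \<le> q" "q \<le> p"
    using e by (auto simp: q_def)
  have [measurable]: "\<Omega> \<in> sets lebesgue" using assms(3) by auto
  have summand: "ennreal (norm (\<Lambda> i) powr q) \<le> ennreal (1 / m i) * J" if i: "i \<in> I" for i
  proof -
    define A where "A = \<Omega> \<inter> (+) (x i) ` U"
    have A: "A \<in> sets (lebesgue_on \<Omega>)" "A \<in> lmeasurable"
      using assms(3,4) lebesgue_sets_translation[OF assms(4), of "x i"]
      by (auto simp: A_def intro: translation_in_lebesgue_on fmeasurable_Int_fmeasurable)
    have "ennreal (norm (\<Lambda> i) powr q) * ennreal (m i)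
        = (\<integral>\<^sup>+ t. ennreal (norm (\<Lambda> i) powr q) * indicator A t \<partial>lebesgue_on \<Omega>)"
      using A by (simp add: nn_integral_cmult_indicator emeasure_restrict_space
          emeasure_eq_measure2 A_def m_def)
    also have "\<dots> \<le> J"
      unfolding J_def
    proof (rule nn_integral_mono)
      fix t
      show "ennreal (norm (\<Lambda> i) powr q) * indicator A t
          \<le> ennreal (norm (step_function U x I \<Lambda> t) powr q)"
        using q i assms(2) norm_le_step_function[OF assms(2) i, of t x U \<Lambda>]
        by (auto simp: indicator_def A_def intro!: ennreal_leI powr_mono2)
    qed
    finally have "ennreal (1 / m i) * (ennreal (norm (\<Lambda> i) powr q) * ennreal (m i))
        \<le> ennreal (1 / m i) * J"
      by (rule mult_left_mono) simp
    then show ?thesis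
      using assms(5)[OF i] by (simp flip: ennreal_mult')
  qed
  have nonneg: "0 \<le> 1 / m i" for i by (simp add: m_def)
  have "ennreal (\<Sum>i\<in>I. norm (\<Lambda> i) powr q) = (\<Sum>i\<in>I. ennreal (norm (\<Lambda> i) powr q))"
    by simp
  also have "\<dots> \<le> (\<Sum>i\<in>I. ennreal (1 / m i) * J)"
    using summand by (rule sum_mono)
  also have "\<dots> = ennreal (\<Sum>i\<in>I. 1 / m i) * J"
    using nonneg by (simp flip: sum_distrib_right)
  also have "\<dots> \<le> ennreal (1 + (\<Sum>i\<in>I. 1 / m i)) * J"
    by (intro mult_right_mono ennreal_leI) auto
  finally show "ennreal_powr (ennreal (\<Sum>k\<in>I. norm (\<Lambda> k) powr (p - \<epsilon>))) (1 / (p - \<epsilon>))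
    \<le> ennreal (1 + (\<Sum>i\<in>I. 1 / m i)) * ennreal_powr
      (\<integral>\<^sup>+ t. ennreal (norm (step_function U x I \<Lambda> t) powr (p - \<epsilon>)) \<partial>lebesgue_on \<Omega>) (1 / (p - \<epsilon>))"
    using q nonneg by (intro ennreal_powr_le_mult) (auto simp: q_def J_def sum_nonneg)
qed

text \<open>The step function of a unit vector is the indicator of one translate, which vanishes
  almost everywhere on \<Omega> when the intersection is null.\<close>

lemma discrete_norm_unit_eq_0:
  fixes \<Omega> U :: "real set" and x :: "'i \<Rightarrow> real"
  assumes "finite I" "i \<in> I" "\<Omega> \<in> lmeasurable" "U \<in> sets lebesgue"
    and null: "measure lebesgue (\<Omega> \<inter> (+) (x i) ` U) = 0"
  shows "discrete_norm p \<theta> \<Omega> U x I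
    (restrict (\<lambda>j. if j = i then 1 else 0) I :: 'i \<Rightarrow> 'a::real_normed_field) = 0"
proof -
  define A where "A = \<Omega> \<inter> (+) (x i) ` U"
  let ?\<Lambda> = "restrict (\<lambda>j. if j = i then 1 else 0) I :: 'i \<Rightarrow> 'a"
  have A: "A \<in> sets (lebesgue_on \<Omega>)" "A \<in> lmeasurable"
    using assms(3,4) lebesgue_sets_translation[OF assms(4), of "x i"]
    by (auto simp: A_def intro: translation_in_lebesgue_on fmeasurable_Int_fmeasurable)
  have step: "step_function U x I ?\<Lambda> t = indicator ((+) (x i) ` U) t" for t
  proof -
    have "step_function U x I ?\<Lambda> t = (\<Sum>j\<in>I. if j = i then indicator ((+) (x i) ` U) t else 0)"
      unfolding step_function_altdef[OF assms(1)] by (intro sum.cong) auto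
    then show ?thesis using assms(1,2) by simp
  qed
  have "(\<integral>\<^sup>+ t. ennreal (norm (step_function U x I ?\<Lambda> t) powr q) \<partial>lebesgue_on \<Omega>) = 0" for q
  proof -
    have "(\<integral>\<^sup>+ t. ennreal (norm (step_function U x I ?\<Lambda> t) powr q) \<partial>lebesgue_on \<Omega>)
        = (\<integral>\<^sup>+ t. indicator A t \<partial>lebesgue_on \<Omega>)"
      \<comment> \<open>An indicator equals each of its powers, since \<open>0 powr q\<close> is 0
        and \<open>1 powr q\<close> is 1 for every real \<open>q\<close>.\<close>
      by (intro nn_integral_cong) (auto simp: step A_def indicator_def)
    also have "\<dots> = emeasure lebesgue A"
      using A assms(3) by (simp add: emeasure_restrict_space A_def fmeasurableD)
    finally show ?thesis
      using A null by (simp add: emeasure_eq_measure2 A_def)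
  qed
  \<comment> \<open>If no \<epsilon> is admissible, the supremum is \<open>bot\<close>, which is
    again 0 in \<open>ennreal\<close>.\<close>
  then show ?thesis
    by (simp add: discrete_norm_def grand_Lebesgue_norm_def ennreal_powr_def SUP_constant bot_ennreal)
qed

text \<open>Besides equality of the sets, both norm estimates are stated. The second one assumes
  definiteness because translates may meet \<Omega> in null sets: for \<Omega> = {0},
  \<open>U\<close> = (-1, 1) and the single point 0, the discrete norm vanishes identically.\<close>

theorem theorem1:
  fixes \<Omega> U :: "real set" and p \<theta> :: real and x :: "'i \<Rightarrow> real" and I :: "'i set"
  assumes "\<Omega> \<in> sets lebesgue" and "bounded \<Omega>"
    and "1 < p" and "0 \<le> \<theta>"
    and "U \<in> sets lebesgue" and "0 \<in> interior U"
    and "\<And>i. i \<in> I \<Longrightarrow> x i \<in> \<Omega>"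
    and "well_spread \<Omega> U x I"
  shows "(discrete_space p \<theta> \<Omega> U x I :: ('i \<Rightarrow> 'a::real_normed_field) set) = grand_lseq p \<theta> I
    \<and> (\<exists>C>0. \<forall>\<Lambda>\<in>(grand_lseq p \<theta> I :: ('i \<Rightarrow> 'a) set).
          discrete_norm p \<theta> \<Omega> U x I \<Lambda> \<le> ennreal C * grand_lseq_norm p \<theta> I \<Lambda>)
    \<and> ((\<forall>\<Lambda>\<in>(discrete_space p \<theta> \<Omega> U x I :: ('i \<Rightarrow> 'a) set).
          discrete_norm p \<theta> \<Omega> U x I \<Lambda> = 0 \<longrightarrow> (\<forall>i\<in>I. \<Lambda> i = 0)) \<longrightarrow>
       (\<exists>C>0. \<forall>\<Lambda>\<in>(discrete_space p \<theta> \<Omega> U x I :: ('i \<Rightarrow> 'a) set).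
          grand_lseq_norm p \<theta> I \<Lambda> \<le> ennreal C * discrete_norm p \<theta> \<Omega> U x I \<Lambda>))"
proof -
  have \<Omega>: "\<Omega> \<in> lmeasurable"
    using assms(1,2) by (simp add: bounded_set_imp_lmeasurable)
  have "bounded (x ` I)"
    using assms(2,7) by (blast intro: bounded_subset)
  then have I: "finite I"
    using assms(6,8) by (auto simp: well_spread_def intro: finite_relatively_separated)
  define C where "C = (1 + card I) powr p * (1 + measure lebesgue \<Omega>)"
  have "C > 0"
    by (auto simp: C_def intro!: mult_pos_pos add_pos_nonneg)
  have upper: "discrete_norm p \<theta> \<Omega> U x I \<Lambda> \<le> ennreal C * grand_lseq_norm p \<theta> I \<Lambda>"
    for \<Lambda> :: "'i \<Rightarrow> 'a"
    unfolding C_def by (rule discrete_norm_le[OF I \<Omega>])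
  \<comment> \<open>With \<open>I\<close> finite every family has finite norm, so both spaces turn
    out to be \<open>extensional I\<close>; this yields their equality.\<close>
  have lseq: "grand_lseq p \<theta> I = (extensional I :: ('i \<Rightarrow> 'a) set)"
    using grand_lseq_norm_finite[OF I assms(3,4)] by (auto simp: grand_lseq_def)
  have "grand_Lebesgue_norm p \<theta> \<Omega> (step_function U x I \<Lambda>) < top" for \<Lambda> :: "'i \<Rightarrow> 'a"
    using upper[of \<Lambda>] grand_lseq_norm_finite[OF I assms(3,4), of \<Lambda>]
    by (auto simp: discrete_norm_def ennreal_mult_less_top intro: le_less_trans)
  then have discrete: "discrete_space p \<theta> \<Omega> U x I = (extensional I :: ('i \<Rightarrow> 'a) set)"
    using step_function_measurable[OF I assms(1,5)]
    by (auto simp: discrete_space_def grand_Lebesgue_def)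
  have "\<exists>C>0. \<forall>\<Lambda>\<in>(discrete_space p \<theta> \<Omega> U x I :: ('i \<Rightarrow> 'a) set).
      grand_lseq_norm p \<theta> I \<Lambda> \<le> ennreal C * discrete_norm p \<theta> \<Omega> U x I \<Lambda>"
    if definite: "\<forall>\<Lambda>\<in>(discrete_space p \<theta> \<Omega> U x I :: ('i \<Rightarrow> 'a) set).
      discrete_norm p \<theta> \<Omega> U x I \<Lambda> = 0 \<longrightarrow> (\<forall>i\<in>I. \<Lambda> i = 0)"
  proof -
    have "0 < measure lebesgue (\<Omega> \<inter> (+) (x i) ` U)" if i: "i \<in> I" for i
    proof (rule ccontr)
      assume "\<not> ?thesis"
      then have "measure lebesgue (\<Omega> \<inter> (+) (x i) ` U) = 0"
        by (simp add: zero_less_measure_iff)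
      \<comment> \<open>The unit vector at \<open>i\<close> would have discrete norm 0,
        contradicting definiteness at its coordinate 1.\<close>
      note discrete_norm_unit_eq_0[where x = x and 'a = 'a, OF I i \<Omega> assms(5) this]
      moreover have "restrict (\<lambda>j. if j = i then 1 else 0) I \<in> (discrete_space p \<theta> \<Omega> U x I :: ('i \<Rightarrow> 'a) set)"
        unfolding discrete by simp
      ultimately have "restrict (\<lambda>j. if j = i then 1 else 0) I i = (0 :: 'a)"
        using definite i by blast
      then show False using i by simp
    qed
    then have "grand_lseq_norm p \<theta> I \<Lambda> \<le>
        ennreal (1 + (\<Sum>i\<in>I. 1 / measure lebesgue (\<Omega> \<inter> (+) (x i) ` U))) *
        discrete_norm p \<theta> \<Omega> U x I \<Lambda>" for \<Lambda> :: "'i \<Rightarrow> 'a"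
      by (rule grand_lseq_norm_le[OF I \<Omega> assms(5)])
    moreover have "0 < 1 + (\<Sum>i\<in>I. 1 / measure lebesgue (\<Omega> \<inter> (+) (x i) ` U))"
      by (intro add_pos_nonneg sum_nonneg) auto
    ultimately show ?thesis by blast
  qed
  then show ?thesis
    using lseq discrete upper \<open>C > 0\<close> by blast
qed

end
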